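(* Let $S_\ell$ be a star with $\ell\ge 2$ leaves. Then \[ \vec{\mathcal{D}}(S_\ell,\mathcal{DT})=\left\lceil\frac{\ell}{2}\right\rceil+1 . \]
   Context: The star $S_\ell$ is the tree consisting of one central vertex adjacent to $\ell$ leaves. $\mathcal{DT}$ denotes the set of all directed rooted trees, i.e. trees with a distinguished vertex, the root, whose edges are all oriented away from the root. For a finite tree $T$, the oriented discrepancy $\vec{\mathcal{D}}(T,\mathcal{DT})$ is defined as follows. Given an orientation $\vec{T}$ of the edges of $T$, a subtree $S$ of $T$ and a vertex $v\in V(S)$ (the root), say an edge $e\in E(S)$ agrees if its orientation in $\vec{T}$ is away from $v$ (i.e. it is directed from its endpoint closer to $v$ to its endpoint farther from $v$), and disagrees otherwise. The imbalance of $(S,v)$ under $\vec{T}$ is the absolute value of the number of agreeing edges of $S$ minus the number of disagreeing edges of $S$. Then \[ \vec{\mathcal{D}}(T,\mathcal{DT})=\min_{\vec{T}}\ \max_{(S,v)}\ \text{imbalance of }(S,v)\text{ under }\vec{T}, \] where the minimum is over all orientations $\vec{T}$ of $T$ and the maximum is over all subtrees $S$ of $T$ and all vertices $v\in V(S)$. *)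

theory Defs
  imports Complex_Main "Graph_Theory.Graph_Theory"
begin

text \<open>
  Undirected graphs are finite simple symmetric digraphs (\<^locale>\<open>pair_graph\<close>): an undirected edge
  is a pair of opposite arcs. The constant \<^const>\<open>tree\<close> is not suitable here: for a symmetric
  digraph it regards the two arcs of an edge as a cycle of length 2. A cycle of an undirected
  graph is a cycle of length at least 3.
\<close>

definition undirected_tree :: "'a pair_pre_digraph \<Rightarrow> bool" where
  "undirected_tree T \<longleftrightarrow> pair_graph T \<and> connected (with_proj T) \<and>
     \<not> (\<exists>p. pre_digraph.cycle (with_proj T) p \<and> 3 \<le> length p)"

definition subtree :: "'a pair_pre_digraph \<Rightarrow> 'a pair_pre_digraph \<Rightarrow> bool" where
  "subtree S T \<longleftrightarrow> subgraph (with_proj S) (with_proj T) \<and> undirected_tree S"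

definition star :: "nat \<Rightarrow> 'a pair_pre_digraph \<Rightarrow> bool" where
  "star l T \<longleftrightarrow> (\<exists>c L. finite L \<and> card L = l \<and> c \<notin> L \<and>
     pverts T = insert c L \<and> parcs T = {c} \<times> L \<union> L \<times> {c})"

text \<open>An orientation selects exactly one of the two arcs of every edge.\<close>

definition orientations :: "'a pair_pre_digraph \<Rightarrow> ('a \<times> 'a) set set" where
  "orientations T = {D. D \<subseteq> parcs T \<and>
     (\<forall>x y. (x, y) \<in> parcs T \<longrightarrow> ((x, y) \<in> D) \<noteq> ((y, x) \<in> D))}"

text \<open>Graph distance: shortest paths with respect to unit weights.\<close>

definition graph_dist :: "'a pair_pre_digraph \<Rightarrow> 'a \<Rightarrow> 'a \<Rightarrow> ereal" where
  "graph_dist S u v = wf_digraph.\<mu> (with_proj S) (\<lambda>_. 1) u v"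

text \<open>
  For an orientation \<open>D\<close> of a tree containing \<open>S\<close>, the set \<open>D \<inter> parcs S\<close> contains exactly one
  arc for every edge of \<open>S\<close>.
\<close>

definition agreeing :: "('a \<times> 'a) set \<Rightarrow> 'a pair_pre_digraph \<Rightarrow> 'a \<Rightarrow> ('a \<times> 'a) set" where
  "agreeing D S v = {(x, y) \<in> D \<inter> parcs S. graph_dist S v x < graph_dist S v y}"

definition disagreeing :: "('a \<times> 'a) set \<Rightarrow> 'a pair_pre_digraph \<Rightarrow> 'a \<Rightarrow> ('a \<times> 'a) set" where
  "disagreeing D S v = (D \<inter> parcs S) - agreeing D S v"

definition imbalance :: "('a \<times> 'a) set \<Rightarrow> 'a pair_pre_digraph \<Rightarrow> 'a \<Rightarrow> int" where
  "imbalance D S v = \<bar>int (card (agreeing D S v)) - int (card (disagreeing D S v))\<bar>"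

definition oriented_discrepancy_DT :: "'a pair_pre_digraph \<Rightarrow> int" where
  "oriented_discrepancy_DT T =
     Min ((\<lambda>D. Max {imbalance D S v | S v. subtree S T \<and> v \<in> pverts S}) ` orientations T)"

lemma star_imp_pair_graph:
  assumes "star l T"
  shows "pair_graph T"
proof -
  from assms obtain c L where *: "finite L" "c \<notin> L" "pverts T = insert c L"
    "parcs T = {c} \<times> L \<union> L \<times> {c}"
    unfolding star_def by blast
  have fin: "finite (pverts T)" "finite (parcs T)"
    unfolding *(3,4) using *(1) by simp_all
  have sym: "sym (parcs T)"
    unfolding *(4) by (rule symI) blast
  show ?thesis
  proof unfold_locales
    show "fst e \<in> pverts T" "snd e \<in> pverts T" "fst e \<noteq> snd e" if "e \<in> parcs T" for e
      using that *(2) unfolding *(3,4) by auto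
    show "symmetric (with_proj T)"
      using sym by (simp add: symmetric_def)
  qed (fact fin)+
qed

lemma star_imp_undirected_tree:
  assumes "star l T"
  shows "undirected_tree T"
proof -
  from assms obtain c L where *: "finite L" "c \<notin> L" "pverts T = insert c L"
    "parcs T = {c} \<times> L \<union> L \<times> {c}"
    unfolding star_def by blast
  interpret pair_graph T by (rule star_imp_pair_graph[OF assms])
  have c1: "c \<rightarrow>\<^sup>*\<^bsub>with_proj T\<^esub> x" if "x \<in> pverts T" for x
    using that * by (cases "x = c") auto
  have c2: "x \<rightarrow>\<^sup>*\<^bsub>with_proj T\<^esub> c" if "x \<in> pverts T" for x
    using that * by (cases "x = c") auto
  have "connected (with_proj T)"
  proof (rule connectedI)
    show "pverts T \<noteq> {}"
      using *(3) by simp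
    show "u \<rightarrow>\<^sup>*\<^bsub>with_proj (mk_symmetric (with_proj T))\<^esub> v" if "u \<in> pverts T" "v \<in> pverts T" for u v
      by (rule reachable_mk_symmetricI[OF reachable_trans[OF c2[OF that(1)] c1[OF that(2)]]])
  qed
  moreover have False if p: "cycle p" "3 \<le> length p" for p
  proof -
    obtain u where u: "awalk u p u" "distinct (tl (pawalk_verts u p))"
      using p(1) unfolding cycle_def by blast
    obtain a1 b1 a2 b2 a3 b3 q where q: "p = (a1, b1) # (a2, b2) # (a3, b3) # q"
      using p(2) by (auto simp: numeral_3_eq_3 Suc_le_length_iff)
    have last_in: "w' \<in> set (pawalk_verts w r)" if "pcas w r w'" for w r w'
      using that by (induction r arbitrary: w) auto
    have first_in: "w \<in> set (pawalk_verts w r)" if "pcas w r w'" for w r w'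
      using that by (cases r) auto
    have walk: "pcas u p u" and arcs: "set p \<subseteq> parcs T"
      using u(1) unfolding awalk_def by auto
    have eqs: "a1 = u" "a2 = b1" "a3 = b2" and rest: "pcas b3 q u"
      using walk unfolding q by auto
    have "b1 \<noteq> b3" "b2 \<noteq> u"
      using u(2) last_in[OF rest] first_in[OF rest] unfolding q eqs by auto
    moreover have "(u, b1) \<in> parcs T" "(b1, b2) \<in> parcs T" "(b2, b3) \<in> parcs T"
      using arcs unfolding q eqs by auto
    ultimately show False
      using *(2) unfolding *(4) by auto
  qed
  ultimately show ?thesis
    using star_imp_pair_graph[OF assms] unfolding undirected_tree_def by metis
qed

end

theory Submission
  imports Defs
begin

text \<open>
  Every subtree of a star with centre \<open>c\<close> is again a star: either it consists of a single vertex,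
  or it is formed by \<open>c\<close> and a set \<open>K\<close> of leaves (\<open>subtree_star_graph_cases\<close>). In such a substar let
  \<open>a\<close> edges point from \<open>c\<close> to a leaf and \<open>b\<close> edges from a leaf to \<open>c\<close>. Seen from the root \<open>c\<close>, the
  \<open>a\<close> outgoing edges agree and the \<open>b\<close> incoming edges disagree. Moving the root to a leaf reverses the
  judgement on one edge only, the one at that leaf. So the imbalance is \<open>\<bar>a - b\<bar>\<close> at the centre,
  \<open>\<bar>a - b + 2\<bar>\<close> at a leaf with incoming edge, and \<open>\<bar>a - b - 2\<bar>\<close> at a leaf with outgoing edge
  (\<open>imbalance_star_graph\<close>).

  For the upper bound, let the orientation of the whole star have \<open>A\<close> outgoing and \<open>B\<close> incoming
  edges. Then \<open>a \<le> A\<close> and \<open>b \<le> B\<close>. The correction by \<open>+2\<close> occurs only if \<open>b \<ge> 1\<close>, and the one by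
  \<open>-2\<close> only if \<open>a \<ge> 1\<close>, so no imbalance exceeds \<open>max A B + 1\<close>; an orientation that is as
  balanced as possible has \<open>max A B = \<lceil>l/2\<rceil>\<close>.

  For the lower bound, if both kinds of edges occur, take all edges of the majority kind and a single
  edge of the other kind, and root this substar at the leaf of the single edge: the
  correction by \<open>2\<close> turns the difference \<open>max A B - 1\<close> into \<open>max A B + 1\<close>. If only one kind
  occurs, the whole star rooted at its centre has imbalance \<open>l\<close>, which is at least \<open>\<lceil>l/2\<rceil> + 1\<close>
  because \<open>l \<ge> 2\<close>.
\<close>

section \<open>Graph distances of at most two\<close>

context pair_wf_digraph
begin

lemma graph_dist_le_length:
  assumes "awalk u p v"
  shows "graph_dist G u v \<le> ereal (real (length p))"
  using min_cost_le_walk_cost[OF assms, of "\<lambda>_. 1"]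
  by (simp add: graph_dist_def awalk_cost_def sum_list_triv)

lemma graph_dist_geI:
  assumes "\<And>p. awalk u p v \<Longrightarrow> n \<le> length p"
  shows "ereal (real n) \<le> graph_dist G u v"
  unfolding graph_dist_def \<mu>_def
  using assms by (intro INF_greatest) (auto simp: awalk_cost_def sum_list_triv)

lemma graph_dist_self:
  assumes "v \<in> pverts G"
  shows "graph_dist G v v = 0"
proof (rule antisym)
  show "graph_dist G v v \<le> 0"
    using graph_dist_le_length[of v "[]" v] assms by (simp add: awalk_Nil_iff zero_ereal_def)
  show "0 \<le> graph_dist G v v"
    using graph_dist_geI[of v v 0] by (simp add: zero_ereal_def)
qed

lemma graph_dist_arc:
  assumes "(u, v) \<in> parcs G" "u \<noteq> v"
  shows "graph_dist G u v = 1"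
proof (rule antisym)
  have "awalk u [(u, v)] v"
    using assms(1) arc_snd_in_verts[OF assms(1)] arc_fst_in_verts[OF assms(1)]
    by (auto simp: awalk_Cons_iff awalk_Nil_iff)
  from graph_dist_le_length[OF this] show "graph_dist G u v \<le> 1"
    by (simp add: one_ereal_def)
  have "1 \<le> length p" if "awalk u p v" for p
    using that assms(2) by (cases p) (auto simp: awalk_Nil_iff)
  from graph_dist_geI[OF this] show "1 \<le> graph_dist G u v"
    by (simp add: one_ereal_def)
qed

lemma graph_dist_ge_2:
  assumes "(u, v) \<notin> parcs G" "u \<noteq> v"
  shows "2 \<le> graph_dist G u v"
proof -
  have "2 \<le> length p" if "awalk u p v" for p
  proof (rule ccontr)
    assume "\<not> 2 \<le> length p"
    then consider "p = []" | e where "p = [e]"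
      by (cases p; cases "tl p") auto
    then show False
      using that assms by cases (auto simp: awalk_Nil_iff awalk_Cons_iff)
  qed
  from graph_dist_geI[OF this] show ?thesis
    by simp
qed

end

section \<open>Stars and their subtrees\<close>

definition star_graph :: "'a \<Rightarrow> 'a set \<Rightarrow> 'a pair_pre_digraph" where
  "star_graph c L = \<lparr>pverts = insert c L, parcs = {c} \<times> L \<union> L \<times> {c}\<rparr>"

lemma pverts_star_graph [simp]: "pverts (star_graph c L) = insert c L"
  and parcs_star_graph [simp]: "parcs (star_graph c L) = {c} \<times> L \<union> L \<times> {c}"
  by (simp_all add: star_graph_def)

lemma star_iff_star_graph:
  "star l T \<longleftrightarrow> (\<exists>c L. finite L \<and> card L = l \<and> c \<notin> L \<and> T = star_graph c L)"
proof -
  have "T = star_graph c L \<longleftrightarrow> pverts T = insert c L \<and> parcs T = {c} \<times> L \<union> L \<times> {c}" for c L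
    by (auto intro: pair_pre_digraph.equality)
  then show ?thesis
    by (simp add: star_def)
qed

lemma star_star_graph:
  assumes "finite L" "c \<notin> L"
  shows "star (card L) (star_graph c L)"
  using assms star_iff_star_graph by blast

lemma pair_wf_digraph_star_graph: "pair_wf_digraph (star_graph c L)"
  by unfold_locales auto

lemma subtree_star_graph:
  assumes "finite L" "c \<notin> L" "K \<subseteq> L"
  shows "subtree (star_graph c K) (star_graph c L)"
proof -
  have "undirected_tree (star_graph c K)"
    using assms by (intro star_imp_undirected_tree[OF star_star_graph]) (auto dest: finite_subset)
  moreover have "subgraph (with_proj (star_graph c K)) (with_proj (star_graph c L))"
    using assms(3)
    by (auto simp: subgraph_def compatible_def wf_digraph_wp_iff pair_wf_digraph_star_graph)
  ultimately show ?thesis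
    by (simp add: subtree_def)
qed

text \<open>
  A vertex of a connected graph with further vertices has an incident arc. In a star the only arc at
  a leaf leads to the centre. Hence a subtree without the centre is a single vertex, here viewed as a
  star without leaves, and a subtree with the centre contains the edge to each of its leaves.
\<close>

lemma subtree_star_graph_cases:
  assumes "subtree S (star_graph c L)" "c \<notin> L"
  obtains v where "S = star_graph v {}"
  | K where "K \<subseteq> L" "S = star_graph c K"
proof -
  have verts: "pverts S \<subseteq> insert c L" and arcs: "parcs S \<subseteq> {c} \<times> L \<union> L \<times> {c}"
    using assms(1) by (auto simp: subtree_def subgraph_def)
  have tree: "pair_graph S" "connected (with_proj S)"
    using assms(1) by (auto simp: subtree_def undirected_tree_def)
  interpret pair_graph S by (rule tree(1))
  have sym: "(y, x) \<in> parcs S" if "(x, y) \<in> parcs S" for x y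
    using pair_sym_arcs that unfolding symmetric_def by (simp add: sym_def)
  have ends: "x \<in> pverts S" "y \<in> pverts S" if "(x, y) \<in> parcs S" for x y
    using arc_fst_in_verts[OF that] arc_snd_in_verts[OF that] by simp_all
  have nonempty: "pverts S \<noteq> {}"
    using tree(2) by (simp add: connected_def strongly_connected_def)
  have arc_at: "\<exists>z. (x, z) \<in> parcs S" if "x \<in> pverts S" "y \<in> pverts S" "x \<noteq> y" for x y
  proof -
    have "x \<rightarrow>\<^sup>*\<^bsub>with_proj (mk_symmetric (with_proj S))\<^esub> y"
      using tree(2) that by (simp add: connected_def strongly_connected_def)
    then have "x \<rightarrow>\<^sup>*\<^bsub>with_proj S\<^esub> y"
      using reachable_mk_symmetric_eq[OF pair_sym_arcs] by simp
    then show ?thesis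
      using that(3) by (cases rule: converse_reachable_cases) auto
  qed
  show thesis
  proof (cases "c \<in> pverts S")
    case True
    define K where "K = pverts S - {c}"
    have "K \<subseteq> L"
      using verts by (auto simp: K_def)
    have "(y, c) \<in> parcs S" if "y \<in> K" for y
      using arc_at[of y c] that True arcs assms(2) \<open>K \<subseteq> L\<close> by (auto simp: K_def)
    then have "{c} \<times> K \<union> K \<times> {c} \<subseteq> parcs S"
      using sym by auto
    moreover have "parcs S \<subseteq> {c} \<times> K \<union> K \<times> {c}"
      using arcs assms(2) ends by (auto simp: K_def)
    ultimately have "S = star_graph c K"
      using True by (intro pair_pre_digraph.equality) (auto simp: K_def)
    with \<open>K \<subseteq> L\<close> show thesis by (rule that(2))
  next
    case False
    have no_arcs: "parcs S = {}"
      using arcs ends False by auto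
    obtain v where "v \<in> pverts S"
      using nonempty by blast
    then have "pverts S = {v}"
      using arc_at no_arcs by blast
    with no_arcs have "S = star_graph v {}"
      by (intro pair_pre_digraph.equality) auto
    then show thesis by (rule that(1))
  qed
qed

section \<open>The imbalance of a rooted star\<close>

lemma graph_dist_star_graph_less_iff:
  assumes "c \<notin> K" "y \<in> K" "v \<in> insert c K"
  shows "graph_dist (star_graph c K) v c < graph_dist (star_graph c K) v y \<longleftrightarrow> v \<noteq> y"
    and "graph_dist (star_graph c K) v y < graph_dist (star_graph c K) v c \<longleftrightarrow> v = y"
proof -
  interpret pair_wf_digraph "star_graph c K" by (rule pair_wf_digraph_star_graph)
  let ?d = "graph_dist (star_graph c K)"
  consider "v = c" | "v = y" | "v \<in> K" "v \<noteq> y"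
    using assms(3) by blast
  then have "(?d v c < ?d v y \<longleftrightarrow> v \<noteq> y) \<and> (?d v y < ?d v c \<longleftrightarrow> v = y)"
  proof cases
    case 1
    then have "?d v c = 0" "?d v y = 1" "v \<noteq> y"
      using assms graph_dist_self[of c] graph_dist_arc[of c y] by auto
    then show ?thesis by simp
  next
    case 2
    then have "?d v c = 1" "?d v y = 0"
      using assms graph_dist_self[of y] graph_dist_arc[of y c] by auto
    with 2 show ?thesis by simp
  next
    case 3
    have "?d v c = 1"
      using 3 assms graph_dist_arc[of v c] by auto
    also have "1 < (2 :: ereal)"
      by simp
    also have "2 \<le> ?d v y"
      using 3 assms by (intro graph_dist_ge_2) auto
    finally show ?thesis
      using 3 by auto
  qed
  then show "?d v c < ?d v y \<longleftrightarrow> v \<noteq> y" "?d v y < ?d v c \<longleftrightarrow> v = y"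
    by auto
qed

lemma agreeing_star_graph:
  assumes "c \<notin> K" "v \<in> insert c K"
  shows "agreeing D (star_graph c K) v =
    {c} \<times> (K \<inter> D `` {c} - {v}) \<union> (K \<inter> D\<inverse> `` {c} \<inter> {v}) \<times> {c}"
  using graph_dist_star_graph_less_iff[OF assms(1) _ assms(2)] assms
  by (auto simp: agreeing_def)

lemma disagreeing_star_graph:
  assumes "c \<notin> K" "v \<in> insert c K"
  shows "disagreeing D (star_graph c K) v =
    {c} \<times> (K \<inter> D `` {c} \<inter> {v}) \<union> (K \<inter> D\<inverse> `` {c} - {v}) \<times> {c}"
  unfolding disagreeing_def agreeing_star_graph[OF assms] using assms by auto

text \<open>
  The sets \<open>D `` {c}\<close> and \<open>D\<inverse> `` {c}\<close> consist of the leaves with outgoing and with incoming edge,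
  seen from the centre. The two correction terms account for the edge at a root that is a leaf: it
  moves from one side of the difference to the other.
\<close>

lemma imbalance_star_graph:
  assumes "finite K" "c \<notin> K" "v \<in> insert c K"
  shows "imbalance D (star_graph c K) v =
    \<bar>int (card (K \<inter> D `` {c})) - int (card (K \<inter> D\<inverse> `` {c}))
      + 2 * of_bool (v \<in> K \<inter> D\<inverse> `` {c}) - 2 * of_bool (v \<in> K \<inter> D `` {c})\<bar>"
proof -
  have card_edges: "card ({c} \<times> X \<union> Y \<times> {c}) = card X + card Y" if "X \<subseteq> K" "Y \<subseteq> K" for X Y
  proof -
    have "finite X" "finite Y" and disj: "({c} \<times> X) \<inter> (Y \<times> {c}) = {}"
      using that assms by (auto dest: finite_subset)
    then show ?thesis
      by (simp add: card_Un_disjoint card_cartesian_product)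
  qed
  have remove: "int (card (X - {v})) = int (card X) - of_bool (v \<in> X)"
    and keep: "int (card (X \<inter> {v})) = of_bool (v \<in> X)" if "X \<subseteq> K" for X
  proof -
    have "finite X"
      using that assms(1) finite_subset by blast
    then show "int (card (X - {v})) = int (card X) - of_bool (v \<in> X)"
      using card_Suc_Diff1[of X v] by (cases "v \<in> X") auto
    show "int (card (X \<inter> {v})) = of_bool (v \<in> X)"
      by (cases "v \<in> X") auto
  qed
  let ?O = "K \<inter> D `` {c}" and ?I = "K \<inter> D\<inverse> `` {c}"
  have "int (card (agreeing D (star_graph c K) v)) =
      int (card ?O) - of_bool (v \<in> ?O) + of_bool (v \<in> ?I)"
    unfolding agreeing_star_graph[OF assms(2,3)]
    by (subst card_edges) (use remove[of ?O] keep[of ?I] in auto)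
  moreover have "int (card (disagreeing D (star_graph c K) v)) =
      int (card ?I) - of_bool (v \<in> ?I) + of_bool (v \<in> ?O)"
    unfolding disagreeing_star_graph[OF assms(2,3)]
    by (subst card_edges) (use remove[of ?I] keep[of ?O] in auto)
  ultimately show ?thesis
    unfolding imbalance_def by (simp add: algebra_simps)
qed

section \<open>Bounds for a fixed orientation\<close>

lemma orientation_star_graphD:
  assumes "D \<in> orientations (star_graph c L)" "c \<notin> L"
  shows "D `` {c} \<union> D\<inverse> `` {c} = L" "D `` {c} \<inter> D\<inverse> `` {c} = {}"
proof -
  have D: "D \<subseteq> parcs (star_graph c L) \<and>
    (\<forall>x y. (x, y) \<in> parcs (star_graph c L) \<longrightarrow> ((x, y) \<in> D) \<noteq> ((y, x) \<in> D))"
    using assms(1) unfolding orientations_def by (rule CollectD)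
  have sub: "D \<subseteq> {c} \<times> L \<union> L \<times> {c}"
    using conjunct1[OF D] by simp
  have one: "((c, y) \<in> D) \<noteq> ((y, c) \<in> D)" if "y \<in> L" for y
    using conjunct2[OF D, rule_format, of c y] that by simp
  show "D `` {c} \<union> D\<inverse> `` {c} = L"
    using sub one assms(2) by blast
  show "D `` {c} \<inter> D\<inverse> `` {c} = {}"
    using sub one assms(2) by blast
qed

text \<open>
  A root at a leaf with incoming edge adds \<open>2\<close> to the difference, but that edge itself contributes
  \<open>-1\<close>; so the gain over the number of outgoing edges is at most \<open>1\<close>. The other case is symmetric.
\<close>

lemma imbalance_star_graph_le:
  assumes "D \<in> orientations (star_graph c L)" "finite L" "c \<notin> L"
    and "subtree S (star_graph c L)" "v \<in> pverts S"
  shows "imbalance D S v \<le> int (max (card (D `` {c})) (card (D\<inverse> `` {c}))) + 1"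
  using assms(4,3)
proof (cases rule: subtree_star_graph_cases)
  case (1 w)
  then show ?thesis
    using imbalance_star_graph[of "{}" w v D] assms(5) by simp
next
  case (2 K)
  let ?O = "K \<inter> D `` {c}" and ?I = "K \<inter> D\<inverse> `` {c}"
  note parts = orientation_star_graphD[OF assms(1,3)]
  have "finite (D `` {c} \<union> D\<inverse> `` {c})"
    using parts(1) assms(2) by simp
  then have fin: "finite (D `` {c})" "finite (D\<inverse> `` {c})" and "finite K"
    using finite_subset[OF 2(1) assms(2)] by auto
  then have le: "card ?O \<le> card (D `` {c})" "card ?I \<le> card (D\<inverse> `` {c})"
    by (auto intro: card_mono)
  have pos: "card ?O \<ge> 1" if "v \<in> ?O"
    using card_mono[of ?O "{v}"] that \<open>finite K\<close> by auto
  have pos': "card ?I \<ge> 1" if "v \<in> ?I"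
    using card_mono[of ?I "{v}"] that \<open>finite K\<close> by auto
  have excl: "\<not> (v \<in> ?O \<and> v \<in> ?I)"
    using parts(2) by blast
  have imb: "imbalance D S v = \<bar>int (card ?O) - int (card ?I)
      + 2 * of_bool (v \<in> ?I) - 2 * of_bool (v \<in> ?O)\<bar>"
    unfolding 2(2) using 2 assms(3,5) by (intro imbalance_star_graph \<open>finite K\<close>) auto
  consider "v \<in> ?O" "v \<notin> ?I" | "v \<in> ?I" "v \<notin> ?O" | "v \<notin> ?O" "v \<notin> ?I"
    using excl by blast
  then show ?thesis
  proof cases
    case 1
    then have "imbalance D S v = \<bar>int (card ?O) - int (card ?I) - 2\<bar>"
      unfolding imb by simp
    then show ?thesis using le pos[OF 1(1)] by linarith
  next
    case 2
    then have "imbalance D S v = \<bar>int (card ?O) - int (card ?I) + 2\<bar>"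
      unfolding imb by simp
    then show ?thesis using le pos'[OF 2(1)] by linarith
  next
    case 3
    then have "imbalance D S v = \<bar>int (card ?O) - int (card ?I)\<bar>"
      unfolding imb by auto
    then show ?thesis using le by linarith
  qed
qed

lemma ex_imbalance_star_graph_ge:
  assumes "D \<in> orientations (star_graph c L)" "finite L" "c \<notin> L" "card L \<ge> 2"
  obtains S v where "subtree S (star_graph c L)" "v \<in> pverts S"
    "imbalance D S v \<ge> (int (card L) + 1) div 2 + 1"
proof -
  note found = that
  let ?O = "D `` {c}" and ?I = "D\<inverse> `` {c}"
  note parts = orientation_star_graphD[OF assms(1,3)]
  have "finite (?O \<union> ?I)"
    using parts(1) assms(2) by simp
  then have fin: "finite ?O" "finite ?I"
    by auto
  have card_L: "card L = card ?O + card ?I"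
    using card_Un_disjoint[OF fin parts(2)] parts(1) by simp
  have witness: thesis
    if "K \<subseteq> L" "v \<in> insert c K" "imbalance D (star_graph c K) v \<ge> (int (card L) + 1) div 2 + 1"
    for K v
    using that(2,3) by (intro found[OF subtree_star_graph[OF assms(2,3) that(1)]]) auto
  show thesis
  proof (cases "?O = {} \<or> ?I = {}")
    case True
    have "L \<inter> ?O = ?O" "L \<inter> ?I = ?I"
      using parts(1) by auto
    then have "imbalance D (star_graph c L) c = int (card L)"
      using imbalance_star_graph[OF assms(2,3), of c D] True card_L assms(3) by auto
    then show thesis
      using assms(4) by (intro witness[of L c]) auto
  next
    case False
    then obtain x y where x: "x \<in> ?O" and y: "y \<in> ?I"
      by blast
    show thesis
    proof (cases "card ?I \<le> card ?O")
      case True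
      let ?K = "insert y ?O"
      have sub: "?K \<subseteq> L"
        using parts(1) y by blast
      have *: "?K \<inter> ?O = ?O" "?K \<inter> ?I = {y}" "y \<notin> ?O"
        using parts(2) y by auto
      have "c \<notin> ?K"
        using sub assms(3) by blast
      then have "imbalance D (star_graph c ?K) y = int (card ?O) + 1"
        using fin *(3) by (subst imbalance_star_graph) (simp_all only: *, simp_all)
      then show thesis
        using card_L True by (intro witness[OF sub, of y]) auto
    next
      case False
      let ?K = "insert x ?I"
      have sub: "?K \<subseteq> L"
        using parts(1) x by blast
      have *: "?K \<inter> ?I = ?I" "?K \<inter> ?O = {x}" "x \<notin> ?I"
        using parts(2) x by auto
      have "c \<notin> ?K"
        using sub assms(3) by blast
      then have "imbalance D (star_graph c ?K) x = int (card ?I) + 1"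
        using fin *(3) by (subst imbalance_star_graph) (simp_all only: *, simp_all)
      then show thesis
        using card_L False by (intro witness[OF sub, of x]) auto
    qed
  qed
qed

section \<open>The discrepancy as a minimax value\<close>

lemma ex_balanced_orientation:
  assumes "finite L" "c \<notin> L"
  obtains D where "D \<in> orientations (star_graph c L)"
    "card (D `` {c}) = card L div 2" "card (D\<inverse> `` {c}) = (card L + 1) div 2"
proof -
  obtain A where A: "A \<subseteq> L" "card A = card L div 2"
    using obtain_subset_with_card_n[of "card L div 2" L] by auto
  define D where "D = {c} \<times> A \<union> (L - A) \<times> {c}"
  have "D `` {c} = A" "D\<inverse> `` {c} = L - A"
    using A(1) assms(2) by (auto simp: D_def)
  moreover have "card (L - A) = card L - card A"
    using A(1) assms(1) by (meson card_Diff_subset finite_subset)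
  moreover have "D \<in> orientations (star_graph c L)"
    using A(1) assms(2) by (auto simp: orientations_def D_def)
  ultimately show thesis
    using A(2) by (intro that[of D]) auto
qed

text \<open>
  Finiteness of \<open>T\<close> makes the minimum and the maxima in the definition range over finite sets; the
  lower bound, assumed for every orientation, also guarantees that the maxima are over nonempty sets.
\<close>

lemma oriented_discrepancy_DT_eqI:
  assumes "finite (parcs T)"
    and lower: "\<And>D. D \<in> orientations T \<Longrightarrow>
      \<exists>S v. subtree S T \<and> v \<in> pverts S \<and> k \<le> imbalance D S v"
    and upper: "\<exists>D \<in> orientations T. \<forall>S v. subtree S T \<longrightarrow> v \<in> pverts S \<longrightarrow> imbalance D S v \<le> k"
  shows "oriented_discrepancy_DT T = k"
proof -
  let ?V = "\<lambda>D. {imbalance D S v | S v. subtree S T \<and> v \<in> pverts S}"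
  have fin_or: "finite (orientations T)"
    using assms(1) by (rule finite_subset[rotated, OF finite_Pow_iff[THEN iffD2]])
      (auto simp: orientations_def)
  have fin_V: "finite (?V D)" for D
  proof (rule finite_subset)
    show "?V D \<subseteq> {0..int (card (parcs T))}"
    proof clarsimp
      fix S v assume "subtree S T"
      then have "parcs S \<subseteq> parcs T"
        by (simp add: subtree_def subgraph_def)
      then have "card (agreeing D S v) \<le> card (parcs T)" "card (disagreeing D S v) \<le> card (parcs T)"
        using assms(1) by (auto simp: agreeing_def disagreeing_def intro!: card_mono)
      then show "0 \<le> imbalance D S v \<and> imbalance D S v \<le> int (card (parcs T))"
        by (simp add: imbalance_def)
    qed
  qed simp
  have ge: "k \<le> Max (?V D)" if D: "D \<in> orientations T" for D
  proof -
    obtain S v where "subtree S T" "v \<in> pverts S" "k \<le> imbalance D S v"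
      using lower[OF D] by blast
    then show ?thesis
      by (intro order_trans[OF _ Max_ge[OF fin_V]]) auto
  qed
  obtain D where D: "D \<in> orientations T"
    and D_le: "\<And>S v. subtree S T \<Longrightarrow> v \<in> pverts S \<Longrightarrow> imbalance D S v \<le> k"
    using upper by blast
  have "?V D \<noteq> {}"
    using lower[OF D] by blast
  then have "Max (?V D) \<le> k"
    using fin_V D_le by (subst Max_le_iff) auto
  with ge[OF D] have "k = Max (?V D)"
    by simp
  then show ?thesis
    unfolding oriented_discrepancy_DT_def
    using D ge fin_or by (intro Min_eqI) auto
qed

theorem proposition11:
  fixes T :: "'a pair_pre_digraph" and l :: nat
  assumes "l \<ge> 2" and "star l T"
  shows "oriented_discrepancy_DT T = \<lceil>real l / 2\<rceil> + 1"
proof -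
  obtain c L where L: "finite L" "card L = l" "c \<notin> L" and T: "T = star_graph c L"
    using assms(2) by (auto simp: star_iff_star_graph)
  have ceil: "\<lceil>real l / 2\<rceil> = (int l + 1) div 2"
    by linarith
  show ?thesis
    unfolding ceil
  proof (rule oriented_discrepancy_DT_eqI)
    show "finite (parcs T)"
      using L(1) by (simp add: T)
    show "\<exists>S v. subtree S T \<and> v \<in> pverts S \<and> (int l + 1) div 2 + 1 \<le> imbalance D S v"
      if "D \<in> orientations T" for D
      using that ex_imbalance_star_graph_ge[of D c L] L assms(1) unfolding T by metis
    obtain D where D: "D \<in> orientations T"
      "card (D `` {c}) = l div 2" "card (D\<inverse> `` {c}) = (l + 1) div 2"
      using ex_balanced_orientation[OF L(1,3)] unfolding L(2) T by metis
    have "int (max (l div 2) ((l + 1) div 2)) = (int l + 1) div 2"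
      by linarith
    then show "\<exists>D \<in> orientations T. \<forall>S v. subtree S T \<longrightarrow> v \<in> pverts S \<longrightarrow>
        imbalance D S v \<le> (int l + 1) div 2 + 1"
      using D imbalance_star_graph_le[of D c L] L(1,3) unfolding T by metis
  qed
qed

end
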